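(* Let $d\ge 1$ and $m\ge 2$ be integers, let $\boldsymbol{\Omega}=\{\Omega_{\boldsymbol{i}}:\boldsymbol{i}\in\mathbb{N}_m^d\}$ be the jittered partition of $[0,1]^d$ into $m^d$ cubes, and let $\mathcal{P}_{\boldsymbol{\Omega}}$ be the associated jittered point set of $N=m^d$ random points. For every nonempty subset $s\subseteq\{1,\dots,d\}$, $$\mathbb{E}\,\mathcal{L}_2^2(\mathcal{P}_{\boldsymbol{\Omega}}^s)=\frac{1}{m^{d+|s|}}\left[\left(\frac{m-1}{2}+\frac12\right)^{|s|}-\left(\frac{m-1}{2}+\frac13\right)^{|s|}\right].$$
   Context: $\mathbb{N}_m^d$ is the set of $d$-tuples $\boldsymbol{i}=(i_1,\dots,i_d)$ with entries in $\{1,\dots,m\}$. The jittered partition of $[0,1]^d$ consists of the $m^d$ axis-aligned cubes $\Omega_{\boldsymbol{i}}=\prod_{j=1}^d\left[\frac{i_j-1}{m},\frac{i_j}{m}\right]$, $\boldsymbol{i}\in\mathbb{N}_m^d$, of equal volume $m^{-d}$ (they overlap only on boundaries). The jittered point set $\mathcal{P}_{\boldsymbol{\Omega}}$ consists of $N=m^d$ independent random points, one uniformly distributed in each $\Omega_{\boldsymbol{i}}$. For a nonempty $s\subseteq\{1,\dots,d\}$, $[0,1]^s$ is the $|s|$-dimensional unit cube spanned by the coordinates in $s$, $\mathbf{x}^s$ is the projection of $\mathbf{x}\in[0,1]^d$ to the coordinates in $s$, and for a point set $\mathcal{P}=\{\mathbf{x}_1,\dots,\mathbf{x}_N\}\subset[0,1]^d$,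 $\mathcal{P}^s$ is the projected (multi)set $\{\mathbf{x}_1^s,\dots,\mathbf{x}_N^s\}$. Its $\mathcal{L}_2$-discrepancy is $$\mathcal{L}_2(\mathcal{P}^s)=\left(\int_{[0,1]^s}\left|\frac{\#(\mathcal{P}^s\cap[0,\mathbf{x}^s))}{N}-|[0,\mathbf{x}^s)|\right|^2d\mathbf{x}^s\right)^{1/2},$$ where $[0,\mathbf{x}^s)=\prod_{j\in s}[0,x_j)$, $|\cdot|$ of a set is $|s|$-dimensional Lebesgue measure, and $\#(\mathcal{P}^s\cap[0,\mathbf{x}^s))$ is the number of indices $k\in\{1,\dots,N\}$ with $\mathbf{x}_k^s\in[0,\mathbf{x}^s)$. $\mathbb{E}\mathcal{L}_2^2(\mathcal{P}^s)$ means $\mathbb{E}[\mathcal{L}_2(\mathcal{P}^s)^2]$. *)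

theory Defs
  imports "HOL-Probability.Probability"
begin

text \<open>
  A point of the space spanned by the coordinates in a finite set \<open>s\<close> is an element of
  \<open>s \<rightarrow>\<^sub>E UNIV\<close>, a function that is \<open>undefined\<close> outside \<open>s\<close>. Accordingly, the projection of
  a point to the coordinates in \<open>s\<close> is \<open>restrict x s\<close>, and the \<open>card s\<close>-dimensional Lebesgue
  measure is the product measure below.
\<close>

abbreviation lborel_on :: "nat set \<Rightarrow> (nat \<Rightarrow> real) measure" where
  "lborel_on s \<equiv> Pi\<^sub>M s (\<lambda>_. lborel)"

definition unit_cube :: "nat set \<Rightarrow> (nat \<Rightarrow> real) set" where
  "unit_cube s = (\<Pi>\<^sub>E j\<in>s. {0..1})"

definition anchored_box :: "nat set \<Rightarrow> (nat \<Rightarrow> real) \<Rightarrow> (nat \<Rightarrow> real) set" where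
  "anchored_box s y = (\<Pi>\<^sub>E j\<in>s. {0..<y j})"

text \<open>
  Point sets are families \<open>p\<close> over a finite index set \<open>K\<close>, so points are counted with multiplicity.
\<close>

definition L2_discrepancy :: "nat set \<Rightarrow> 'k set \<Rightarrow> ('k \<Rightarrow> nat \<Rightarrow> real) \<Rightarrow> real" where
  "L2_discrepancy s K p = sqrt (LINT y:unit_cube s|lborel_on s.
     \<bar>real (card {k\<in>K. p k \<in> anchored_box s y}) / real (card K)
        - measure (lborel_on s) (anchored_box s y)\<bar>\<^sup>2)"

definition project_points :: "nat set \<Rightarrow> ('k \<Rightarrow> nat \<Rightarrow> real) \<Rightarrow> 'k \<Rightarrow> nat \<Rightarrow> real" where
  "project_points s p = (\<lambda>k. restrict (p k) s)"

definition multi_indices :: "nat \<Rightarrow> nat \<Rightarrow> (nat \<Rightarrow> nat) set" where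
  "multi_indices d m = (\<Pi>\<^sub>E j\<in>{1..d}. {1..m})"

definition jittered_cell :: "nat \<Rightarrow> nat \<Rightarrow> (nat \<Rightarrow> nat) \<Rightarrow> (nat \<Rightarrow> real) set" where
  "jittered_cell d m i = (\<Pi>\<^sub>E j\<in>{1..d}. {(real (i j) - 1) / real m .. real (i j) / real m})"

definition jittered_point_set ::
    "nat \<Rightarrow> nat \<Rightarrow> 'w measure \<Rightarrow> ((nat \<Rightarrow> nat) \<Rightarrow> 'w \<Rightarrow> nat \<Rightarrow> real) \<Rightarrow> bool" where
  "jittered_point_set d m M X \<longleftrightarrow>
     prob_space M \<and>
     prob_space.indep_vars M (\<lambda>_. lborel_on {1..d}) X (multi_indices d m) \<and>
     (\<forall>i\<in>multi_indices d m.
        distr M (lborel_on {1..d}) (X i)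
          = uniform_measure (lborel_on {1..d}) (jittered_cell d m i))"

end

theory Submission
  imports Defs
begin

text \<open>
  Write \<open>N = m ^ d\<close> and fix \<open>y\<close> in the unit cube of the coordinates in \<open>s\<close>. The number of points that
  project into the box anchored at \<open>0\<close> with corner \<open>y\<close> is a sum of \<open>N\<close> independent indicators,
  one for each cell, with success probabilities \<open>p i y\<close>, the fraction of the cell \<open>i\<close> whose
  projection lies in that box. The cells tile the cube and have equal volume, so the
  probabilities add up to \<open>N\<close> times the volume of the box: the local discrepancy is centred,
  and independence turns the expectation of its square into the sum of the variances
  \<open>p i y - (p i y)\<^sup>2\<close>, divided by \<open>N\<^sup>2\<close>.

  By Fubini's theorem the expected squared discrepancy is the integral over \<open>y\<close> of this normalised sum
  (\<open>expectation_discrepancy_integrand\<close>, \<open>integrable_discrepancy_integrand\<close>).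
  The rest is computation, because everything factors over the coordinates in \<open>s\<close>: \<open>p i y\<close> is the
  product over \<open>j \<in> s\<close> of the fraction of the interval \<open>{(i j - 1) / m .. i j / m}\<close> below \<open>y j\<close>
  (\<open>measure_uniform_cell_lower_box\<close>). As a function of \<open>t\<close>, the fraction of the \<open>k\<close>-th interval below \<open>t\<close>
  is a ramp of width \<open>1 / m\<close> followed by the constant \<open>1\<close>, so its first and second powers
  integrate over \<open>{0..1}\<close> to \<open>(m - k + 1/2) / m\<close> and \<open>(m - k + 1/3) / m\<close>. Summed over \<open>k\<close> these give
  \<open>(m - 1) / 2 + 1/2\<close> and \<open>(m - 1) / 2 + 1/3\<close>, and the sum over all multi-indices raises them to the
  power \<open>card s\<close> and adds a factor \<open>m\<close> for each coordinate outside \<open>s\<close>.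
\<close>

section \<open>The fraction of a subinterval below a threshold\<close>

text \<open>
  The fraction of \<open>{(k - 1) / m .. k / m}\<close> lying below \<open>t\<close>; clamping to \<open>{0..1}\<close> covers the cases where \<open>t\<close>
  lies to the left or to the right of the interval.
\<close>

definition filled :: "nat \<Rightarrow> nat \<Rightarrow> real \<Rightarrow> real" where
  "filled m k t = max 0 (min 1 (real m * t - (real k - 1)))"

lemma filled_measurable [measurable]: "filled m k \<in> borel_measurable borel"
  unfolding filled_def by measurable

lemma filled_bounds: "0 \<le> filled m k t" "filled m k t \<le> 1"
  by (auto simp: filled_def)

lemma measure_slab_below:
  assumes "m \<ge> 1" "k \<ge> 1"
  shows "measure lborel ({(real k - 1) / real m .. real k / real m} \<inter> {0..<t}) = filled m k t / real m"
proof (cases "t \<le> real k / real m")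
  case True
  have "{(real k - 1) / real m .. real k / real m} \<inter> {0..<t} = {(real k - 1) / real m ..< t}"
    using True assms order_trans[of 0 "(real k - 1) / real m"] by auto
  moreover have "real m * t \<le> real k"
    using True assms by (simp add: field_simps)
  ultimately show ?thesis
    using assms by (cases "t \<ge> (real k - 1) / real m") (auto simp: filled_def field_simps)
next
  case False
  have "0 \<le> (real k - 1) / real m" using assms by simp
  then have "{(real k - 1) / real m .. real k / real m} \<inter> {0..<t} = {(real k - 1) / real m .. real k / real m}"
    using False by auto
  moreover have "real m * t \<ge> real k"
    using False assms by (simp add: field_simps)
  moreover have "(real k - 1) / real m \<le> real k / real m"
    by (simp add: divide_right_mono)
  ultimately show ?thesis
    using assms by (auto simp: filled_def field_simps)
qed

text \<open>
  The bound \<open>n\<close> is separate from \<open>m\<close> so that induction can add one interval at a time.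
\<close>

lemma sum_filled_prefix:
  "0 \<le> t \<Longrightarrow> (\<Sum>k = 1..n. filled m k t) = min (real n) (real m * t)"
  by (induction n) (auto simp: filled_def)

lemma sum_filled:
  "0 \<le> t \<Longrightarrow> t \<le> 1 \<Longrightarrow> (\<Sum>k = 1..m. filled m k t) = real m * t"
  using sum_filled_prefix[of t m m] by (simp add: mult_left_le)

text \<open>
  The integrand vanishes up to \<open>a = (k - 1) / m\<close>, is the \<open>r\<close>-th power of a linear ramp up to \<open>b = k / m\<close>, and
  is \<open>1\<close> beyond. The ramp contributes \<open>1 / (m * (r + 1))\<close> and the plateau \<open>1 - k / m\<close>. The exponent
  \<open>r = 0\<close> is excluded because \<open>0 ^ 0 = 1\<close> would make the first piece contribute as well.
\<close>

lemma has_integral_filled_power: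
  assumes "1 \<le> k" "k \<le> m" "r \<ge> 1"
  shows "((\<lambda>t. filled m k t ^ r) has_integral (real m - real k + 1 / (real r + 1)) / real m) {0..1}"
proof -
  define a where "a = (real k - 1) / real m"
  define b where "b = real k / real m"
  have m: "real m > 0" using assms by simp
  have ab: "0 \<le> a" "a \<le> b" "b \<le> 1"
    using assms by (auto simp: a_def b_def divide_right_mono)
  have 1: "((\<lambda>t. filled m k t ^ r) has_integral 0) {0..a}"
  proof (rule has_integral_is_0)
    fix t assume "t \<in> {0..a}"
    then show "filled m k t ^ r = 0" using m assms by (auto simp: a_def filled_def field_simps)
  qed
  have deriv: "((\<lambda>t. (real m * t - (real k - 1)) ^ Suc r / (real m * (real r + 1)))
      has_real_derivative (real m * x - (real k - 1)) ^ r) (at x within T)" for x T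
  proof -
    have "((\<lambda>t. (real m * t - (real k - 1)) ^ Suc r / (real m * (real r + 1)))
        has_real_derivative real (Suc r) * (real m * x - (real k - 1)) ^ r * real m / (real m * (real r + 1)))
        (at x within T)"
      by (auto intro!: derivative_eq_intros simp del: power_Suc)
    moreover have "real (Suc r) * (real m * x - (real k - 1)) ^ r * real m / (real m * (real r + 1))
        = (real m * x - (real k - 1)) ^ r"
      using m by (simp add: nonzero_divide_eq_eq ac_simps)
    ultimately show ?thesis by simp
  qed
  have "((\<lambda>t. (real m * t - (real k - 1)) ^ r) has_integral
      (real m * b - (real k - 1)) ^ Suc r / (real m * (real r + 1))
      - (real m * a - (real k - 1)) ^ Suc r / (real m * (real r + 1))) {a..b}"
    using ab deriv
    by (intro fundamental_theorem_of_calculus)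
       (auto simp del: power_Suc simp: has_real_derivative_iff_has_vector_derivative[symmetric])
  also have "(real m * b - (real k - 1)) ^ Suc r / (real m * (real r + 1))
      - (real m * a - (real k - 1)) ^ Suc r / (real m * (real r + 1)) = 1 / (real m * (real r + 1))"
    using m by (simp add: a_def b_def)
  finally have 2: "((\<lambda>t. filled m k t ^ r) has_integral 1 / (real m * (real r + 1))) {a..b}"
  proof (rule has_integral_eq[rotated])
    fix t assume "t \<in> {a..b}"
    then show "(real m * t - (real k - 1)) ^ r = filled m k t ^ r"
      using m by (auto simp: a_def b_def filled_def field_simps)
  qed
  have 3: "((\<lambda>t. filled m k t ^ r) has_integral (1 - b)) {b..1}"
  proof (rule has_integral_eq)
    show "((\<lambda>t. 1) has_integral (1 - b)) {b..1}"
      using has_integral_const_real[of "1::real" b 1] ab by simp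
    fix t assume "t \<in> {b..1}"
    then show "1 = filled m k t ^ r" using m by (auto simp: b_def filled_def field_simps)
  qed
  have "((\<lambda>t. filled m k t ^ r) has_integral (0 + 1 / (real m * (real r + 1))) + (1 - b)) {0..1}"
    by (rule has_integral_combine[OF _ _ has_integral_combine[OF _ _ 1 2] 3]) (use ab in auto)
  also have "(0 + 1 / (real m * (real r + 1))) + (1 - b) = (real m - real k + 1 / (real r + 1)) / real m"
    using m by (auto simp: b_def add_divide_distrib diff_divide_distrib)
  finally show ?thesis .
qed

lemma integral_filled_power:
  assumes "1 \<le> k" "k \<le> m" "r \<ge> 1"
  shows "(LINT t:{0..1}|lborel. filled m k t ^ r) = (real m - real k + 1 / (real r + 1)) / real m"
    and "set_integrable lborel {0..1} (\<lambda>t. filled m k t ^ r)"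
proof -
  show *: "set_integrable lborel {0..1} (\<lambda>t. filled m k t ^ r)"
    unfolding set_integrable_def
  proof (rule integrableI_bounded_set_indicator[where B = 1])
    show "AE t in lborel. t \<in> {0..1} \<longrightarrow> norm (filled m k t ^ r) \<le> 1"
      by (auto simp: filled_bounds power_le_one)
  qed auto
  show "(LINT t:{0..1}|lborel. filled m k t ^ r) = (real m - real k + 1 / (real r + 1)) / real m"
    using has_integral_filled_power[OF assms] set_borel_integral_eq_integral(2)[OF *]
    by (simp add: integral_unique)
qed

lemma sum_filled_power_integrals:
  "m \<ge> 1 \<Longrightarrow> (\<Sum>k = 1..m. (real m - real k + c) / real m) = (real m - 1) / 2 + c"
proof -
  assume m: "m \<ge> 1"
  \<comment> \<open>The upper limit is decoupled from the minuend to make the induction go through.\<close>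
  have "(\<Sum>k = 1..n. real a - real k + c) = real n * real a - real n * (real n + 1) / 2 + real n * c" for n a
    by (induction n) (auto simp: field_simps)
  from this[of m m] show ?thesis
    using m by (simp add: sum_divide_distrib[symmetric] field_simps)
qed

section \<open>Products over coordinates\<close>

lemma measure_lborel_on_PiE:
  assumes "finite I" "\<And>i. i \<in> I \<Longrightarrow> A i \<in> sets borel" "\<And>i. i \<in> I \<Longrightarrow> emeasure lborel (A i) < \<infinity>"
  shows "measure (lborel_on I) (Pi\<^sub>E I A) = (\<Prod>i\<in>I. measure lborel (A i))"
proof -
  interpret product_sigma_finite "\<lambda>_::nat. lborel :: real measure" ..
  have "emeasure (lborel_on I) (Pi\<^sub>E I A) = (\<Prod>i\<in>I. ennreal (measure lborel (A i)))"
    using assms by (subst emeasure_PiM) (auto intro!: prod.cong emeasure_eq_ennreal_measure dest: less_imp_neq)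
  then show ?thesis
    by (simp add: measure_def prod_ennreal prod_nonneg)
qed

text \<open>
  Distributivity turns the sum over the multi-indices into a product over all \<open>d\<close> coordinates;
  each of the \<open>d - card s\<close> coordinates outside \<open>s\<close> contributes the factor \<open>m\<close>, because it runs
  through \<open>{1..m}\<close> freely.
\<close>

lemma sum_multi_indices_prod:
  fixes g :: "nat \<Rightarrow> nat \<Rightarrow> real"
  assumes "s \<subseteq> {1..d}"
  shows "(\<Sum>i\<in>multi_indices d m. \<Prod>j\<in>s. g j (i j)) = real m ^ (d - card s) * (\<Prod>j\<in>s. \<Sum>k = 1..m. g j k)"
proof -
  have [simp]: "finite s" using assms finite_subset by blast
  have "(\<Sum>i\<in>multi_indices d m. \<Prod>j\<in>s. g j (i j))
      = (\<Sum>i\<in>multi_indices d m. \<Prod>j\<in>{1..d}. if j \<in> s then g j (i j) else 1)"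
    using assms by (simp add: prod.If_cases Int_absorb1)
  also have "\<dots> = (\<Prod>j\<in>{1..d}. \<Sum>k = 1..m. if j \<in> s then g j k else 1)"
    unfolding multi_indices_def by (subst prod_sum_PiE) auto
  also have "\<dots> = (\<Prod>j\<in>{1..d}. if j \<in> s then \<Sum>k = 1..m. g j k else real m)"
    by (intro prod.cong) auto
  also have "\<dots> = (\<Prod>j\<in>s. \<Sum>k = 1..m. g j k) * real m ^ card ({1..d} - s)"
    using assms by (simp add: prod.If_cases Int_absorb1 Diff_eq)
  finally show ?thesis
    using assms by (simp add: card_Diff_subset)
qed

lemma sets_unit_cube [measurable]: "finite s \<Longrightarrow> unit_cube s \<in> sets (lborel_on s)"
  unfolding unit_cube_def by (rule sets_PiM_I_finite) auto

lemma emeasure_unit_cube: "finite s \<Longrightarrow> emeasure (lborel_on s) (unit_cube s) = 1"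
proof -
  interpret product_sigma_finite "\<lambda>_::nat. lborel :: real measure" ..
  show "finite s \<Longrightarrow> emeasure (lborel_on s) (unit_cube s) = 1"
    unfolding unit_cube_def by (subst emeasure_PiM) auto
qed

text \<open>
  On the underlying space, whose elements are \<open>undefined\<close> outside \<open>s\<close>, the indicator of the cube is
  itself a product of one-dimensional indicators, so the product form of Fubini's theorem applies.
\<close>

lemma set_integral_unit_cube_prod:
  fixes g :: "nat \<Rightarrow> real \<Rightarrow> real"
  assumes "finite s" and int: "\<And>j. j \<in> s \<Longrightarrow> set_integrable lborel {0..1} (g j)"
  shows "(LINT y:unit_cube s|lborel_on s. \<Prod>j\<in>s. g j (y j)) = (\<Prod>j\<in>s. LINT t:{0..1}|lborel. g j t)"
    and "set_integrable (lborel_on s) (unit_cube s) (\<lambda>y. \<Prod>j\<in>s. g j (y j))"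
proof -
  interpret product_sigma_finite "\<lambda>_::nat. lborel :: real measure" ..
  have eq: "indicator (unit_cube s) y *\<^sub>R (\<Prod>j\<in>s. g j (y j)) = (\<Prod>j\<in>s. indicator {0..1} (y j) *\<^sub>R g j (y j))"
    if "y \<in> space (lborel_on s)" for y
  proof (cases "y \<in> unit_cube s")
    case True
    then show ?thesis by (auto simp: unit_cube_def PiE_iff)
  next
    case False
    moreover have "y \<in> extensional s"
      using that by (simp add: space_PiM PiE_iff)
    ultimately obtain j where "j \<in> s" "y j \<notin> {0..1}"
      unfolding unit_cube_def PiE_iff by blast
    then have "(\<Prod>j\<in>s. indicator {0..1} (y j) *\<^sub>R g j (y j)) = 0"
      using assms(1) by (intro prod_zero) (auto intro!: bexI[of _ j])
    then show ?thesis using False by simp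
  qed
  show "(LINT y:unit_cube s|lborel_on s. \<Prod>j\<in>s. g j (y j)) = (\<Prod>j\<in>s. LINT t:{0..1}|lborel. g j t)"
  proof -
    have "(LINT y:unit_cube s|lborel_on s. \<Prod>j\<in>s. g j (y j))
        = (LINT y|lborel_on s. (\<Prod>j\<in>s. indicator {0..1} (y j) *\<^sub>R g j (y j)))"
      unfolding set_lebesgue_integral_def by (intro Bochner_Integration.integral_cong refl eq)
    also have "\<dots> = (\<Prod>j\<in>s. LINT t:{0..1}|lborel. g j t)"
      unfolding set_lebesgue_integral_def
      by (rule product_integral_prod[OF assms(1)]) (use int in \<open>simp add: set_integrable_def\<close>)
    finally show ?thesis .
  qed
  show "set_integrable (lborel_on s) (unit_cube s) (\<lambda>y. \<Prod>j\<in>s. g j (y j))"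
    unfolding set_integrable_def
    using product_integrable_prod[OF assms(1), of "\<lambda>j t. indicator {0..1} t *\<^sub>R g j t"] int
    by (subst Bochner_Integration.integrable_cong[OF refl eq]) (simp_all add: set_integrable_def)
qed

section \<open>The probability that a cell's point projects into a box\<close>

text \<open>
  The argument \<open>x\<close> may have coordinates outside \<open>s\<close>: a point is tested without projecting it first.
  The value is real so that counts become sums of random variables.
\<close>

definition in_lower_box :: "nat set \<Rightarrow> (nat \<Rightarrow> real) \<Rightarrow> (nat \<Rightarrow> real) \<Rightarrow> real" where
  "in_lower_box s y x = (if \<forall>j\<in>s. 0 \<le> x j \<and> x j < y j then 1 else 0)"

lemma sets_lower_box:
  assumes "finite s" "s \<subseteq> T"
  shows "{x \<in> space (lborel_on T). \<forall>j\<in>s. 0 \<le> x j \<and> x j < y j} \<in> sets (lborel_on T)"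
proof (intro sets.sets_Collect_finite_All assms)
  fix j assume "j \<in> s"
  then have [measurable]: "(\<lambda>x. x j) \<in> borel_measurable (lborel_on T)"
    using measurable_component_singleton[of j T "\<lambda>_. lborel"] assms by auto
  show "{x \<in> space (lborel_on T). 0 \<le> x j \<and> x j < y j} \<in> sets (lborel_on T)"
    by measurable
qed

lemma borel_measurable_in_lower_box:
  assumes "finite s" "s \<subseteq> T"
  shows "in_lower_box s y \<in> borel_measurable (lborel_on T)"
  unfolding in_lower_box_def
  by (intro measurable_If measurable_const sets_lower_box assms) auto

text \<open>
  Cutting the cell with the preimage of the box leaves a product of intervals, and dividing by the
  volume of the cell removes a factor \<open>1 / m\<close> in every coordinate. The coordinates outside \<open>s\<close>
  are not cut and so contribute \<open>1\<close>; those in \<open>s\<close> contribute the fraction that remains.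
\<close>

lemma measure_uniform_cell_lower_box:
  assumes "m \<ge> 1" "i \<in> multi_indices d m" "s \<subseteq> {1..d}"
  shows "measure (uniform_measure (lborel_on {1..d}) (jittered_cell d m i))
      {x \<in> space (lborel_on {1..d}). \<forall>j\<in>s. 0 \<le> x j \<and> x j < y j} = (\<Prod>j\<in>s. filled m (i j) (y j))"
proof -
  define slab where "slab k = {(real k - 1) / real m .. real k / real m}" for k
  have i: "i j \<ge> 1" if "j \<in> {1..d}" for j
    using assms(2) that by (auto simp: multi_indices_def PiE_iff)
  have slab: "measure lborel (slab k) = 1 / real m" for k
    using assms(1) by (simp add: slab_def divide_right_mono diff_divide_distrib)
  have slab_fin: "emeasure lborel (slab k \<inter> A) < \<infinity>" if "A \<in> sets borel" for k A
    by (rule le_less_trans[OF emeasure_mono[of _ "slab k"]]) (auto simp: slab_def emeasure_lborel_Icc_eq)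
  have cell: "jittered_cell d m i = (\<Pi>\<^sub>E j\<in>{1..d}. slab (i j))"
    by (simp add: jittered_cell_def slab_def)
  have vol: "measure (lborel_on {1..d}) (jittered_cell d m i) = (1 / real m) ^ d"
    unfolding cell using slab_fin[of UNIV]
    by (subst measure_lborel_on_PiE) (auto simp: slab, simp_all add: slab_def)
  then have "measure (lborel_on {1..d}) (jittered_cell d m i) \<noteq> 0" using assms(1) by simp
  \<comment> \<open>A set of infinite \<open>emeasure\<close> has \<open>measure\<close> \<open>0\<close>, so a nonzero \<open>measure\<close> also gives finiteness.\<close>
  then have em: "emeasure (lborel_on {1..d}) (jittered_cell d m i) \<noteq> 0"
      "emeasure (lborel_on {1..d}) (jittered_cell d m i) \<noteq> \<infinity>"
    by (auto simp: measure_def)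
  have cut: "jittered_cell d m i \<inter> {x \<in> space (lborel_on {1..d}). \<forall>j\<in>s. 0 \<le> x j \<and> x j < y j}
      = (\<Pi>\<^sub>E j\<in>{1..d}. slab (i j) \<inter> (if j \<in> s then {0..<y j} else UNIV))"
    (is "?L = ?R")
  proof (intro set_eqI iffI)
    fix x assume "x \<in> ?L"
    then show "x \<in> ?R" by (auto simp: cell PiE_iff)
  next
    fix x assume x: "x \<in> ?R"
    have "0 \<le> x j \<and> x j < y j" if "j \<in> s" for j
      using PiE_mem[OF x, of j] that assms(3) by auto
    then show "x \<in> ?L" using x by (auto simp: cell PiE_iff space_PiM)
  qed
  have fac: "measure lborel (slab (i j) \<inter> (if j \<in> s then {0..<y j} else UNIV))
      = (if j \<in> s then filled m (i j) (y j) else 1) * (1 / real m)" if "j \<in> {1..d}" for j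
    using measure_slab_below[OF assms(1) i[OF that], of "y j"] slab[of "i j"]
    by (simp add: slab_def)
  have "measure (lborel_on {1..d}) (jittered_cell d m i \<inter>
       {x \<in> space (lborel_on {1..d}). \<forall>j\<in>s. 0 \<le> x j \<and> x j < y j})
     = (\<Prod>j\<in>{1..d}. measure lborel (slab (i j) \<inter> (if j \<in> s then {0..<y j} else UNIV)))"
    unfolding cut
  proof (rule measure_lborel_on_PiE)
    fix j
    show "emeasure lborel (slab (i j) \<inter> (if j \<in> s then {0..<y j} else UNIV)) < \<infinity>"
      by (rule slab_fin) simp
  qed (auto simp: slab_def)
  also have "\<dots> = (\<Prod>j\<in>{1..d}. (if j \<in> s then filled m (i j) (y j) else 1) * (1 / real m))"
    by (intro prod.cong fac refl)
  also have "\<dots> = (\<Prod>j\<in>s. filled m (i j) (y j)) * (1 / real m) ^ d"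
    using assms(3) by (subst prod.distrib) (simp add: prod.If_cases Int_absorb1)
  finally have num: "measure (lborel_on {1..d}) (jittered_cell d m i \<inter>
       {x \<in> space (lborel_on {1..d}). \<forall>j\<in>s. 0 \<le> x j \<and> x j < y j})
     = (\<Prod>j\<in>s. filled m (i j) (y j)) * (1 / real m) ^ d" .
  have "{x \<in> space (lborel_on {1..d}). \<forall>j\<in>s. 0 \<le> x j \<and> x j < y j} \<in> sets (lborel_on {1..d})"
    by (rule sets_lower_box) (use assms(3) finite_subset in auto)
  then show ?thesis
    using em num vol assms(1) by (subst measure_uniform_measure) auto
qed

section \<open>Squares of sums of independent centred variables\<close>

text \<open>
  Expanding the square, the mixed terms vanish: by independence the expectation of a product of
  two different summands is the product of two zero expectations.
\<close>

lemma (in prob_space) expectation_square_sum_indep_centered: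
  fixes Y :: "'i \<Rightarrow> 'a \<Rightarrow> real"
  assumes "finite I" and indep: "indep_vars (\<lambda>_. borel) Y I"
    and int: "\<And>i. i \<in> I \<Longrightarrow> integrable M (Y i)"
    and int2: "\<And>i. i \<in> I \<Longrightarrow> integrable M (\<lambda>\<omega>. (Y i \<omega>)\<^sup>2)"
    and centered: "\<And>i. i \<in> I \<Longrightarrow> expectation (Y i) = 0"
  shows "expectation (\<lambda>\<omega>. (\<Sum>i\<in>I. Y i \<omega>)\<^sup>2) = (\<Sum>i\<in>I. expectation (\<lambda>\<omega>. (Y i \<omega>)\<^sup>2))"
proof -
  have prod: "integrable M (\<lambda>\<omega>. Y i \<omega> * Y j \<omega>) \<and>
      expectation (\<lambda>\<omega>. Y i \<omega> * Y j \<omega>) = (if i = j then expectation (\<lambda>\<omega>. (Y i \<omega>)\<^sup>2) else 0)"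
    if "i \<in> I" "j \<in> I" for i j
  proof (cases "i = j")
    case True
    then show ?thesis using int2[of i] that by (simp add: power2_eq_square)
  next
    case False
    have "indep_vars (\<lambda>_. borel) Y {i, j}"
      by (rule indep_vars_subset[OF indep]) (use that in auto)
    from indep_vars_lebesgue_integral[OF _ this] indep_vars_integrable[OF _ this]
    show ?thesis using False int centered that by auto
  qed
  have "expectation (\<lambda>\<omega>. (\<Sum>i\<in>I. Y i \<omega>)\<^sup>2) = expectation (\<lambda>\<omega>. \<Sum>i\<in>I. \<Sum>j\<in>I. Y i \<omega> * Y j \<omega>)"
    by (simp add: power2_eq_square sum_product)
  also have "\<dots> = (\<Sum>i\<in>I. \<Sum>j\<in>I. expectation (\<lambda>\<omega>. Y i \<omega> * Y j \<omega>))"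
    using prod by (simp add: integral_sum integrable_sum)
  also have "\<dots> = (\<Sum>i\<in>I. \<Sum>j\<in>I. if i = j then expectation (\<lambda>\<omega>. (Y i \<omega>)\<^sup>2) else 0)"
    using prod by (intro sum.cong) auto
  finally show ?thesis using assms(1) by simp
qed

text \<open>
  A variable with values in \<open>{0, 1}\<close> equals its own square, which makes its centred square affine in
  the variable and gives the Bernoulli variance \<open>p - p\<^sup>2\<close>.
\<close>

lemma (in prob_space) expectation_square_sum_centered_indicators:
  fixes H :: "'i \<Rightarrow> 'a \<Rightarrow> real"
  assumes "finite I" and indep: "indep_vars (\<lambda>_. borel) H I"
    and bin: "\<And>i \<omega>. i \<in> I \<Longrightarrow> H i \<omega> \<in> {0, 1}"
    and p: "\<And>i. i \<in> I \<Longrightarrow> expectation (H i) = p i"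
  shows "expectation (\<lambda>\<omega>. (\<Sum>i\<in>I. H i \<omega> - p i)\<^sup>2) = (\<Sum>i\<in>I. p i - (p i)\<^sup>2)"
proof -
  have meas [measurable]: "H i \<in> borel_measurable M" if "i \<in> I" for i
    using indep that by (auto simp: indep_vars_def)
  have int [simp]: "integrable M (H i)" if "i \<in> I" for i
  proof (rule integrable_const_bound[where B = 1])
    have "norm (H i \<omega>) \<le> 1" for \<omega>
      using bin[OF that, of \<omega>] by auto
    then show "AE \<omega> in M. norm (H i \<omega>) \<le> 1" by simp
  qed (use meas[OF that] in simp)
  have sq: "(H i \<omega> - p i)\<^sup>2 = (1 - 2 * p i) * H i \<omega> + (p i)\<^sup>2" if "i \<in> I" for i \<omega>
    using bin[OF that, of \<omega>] by (auto simp: power2_eq_square algebra_simps)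
  have "expectation (\<lambda>\<omega>. (\<Sum>i\<in>I. H i \<omega> - p i)\<^sup>2) = (\<Sum>i\<in>I. expectation (\<lambda>\<omega>. (H i \<omega> - p i)\<^sup>2))"
  proof (rule expectation_square_sum_indep_centered[OF assms(1)])
    show "indep_vars (\<lambda>_. borel) (\<lambda>i \<omega>. H i \<omega> - p i) I"
      by (rule indep_vars_compose2[OF indep]) measurable
  qed (auto simp: sq p prob_space)
  also have "\<dots> = (\<Sum>i\<in>I. p i - (p i)\<^sup>2)"
  proof (intro sum.cong refl)
    fix i assume i: "i \<in> I"
    have "expectation (\<lambda>\<omega>. (H i \<omega> - p i)\<^sup>2) = (1 - 2 * p i) * p i + (p i)\<^sup>2"
      using i by (simp add: sq p prob_space)
    then show "expectation (\<lambda>\<omega>. (H i \<omega> - p i)\<^sup>2) = p i - (p i)\<^sup>2"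
      by (simp add: power2_eq_square algebra_simps)
  qed
  finally show ?thesis .
qed

section \<open>The squared local discrepancy\<close>

lemma discrepancy_integrand:
  assumes "finite s" "finite K" "y \<in> unit_cube s"
  shows "\<bar>real (card {k\<in>K. project_points s p k \<in> anchored_box s y}) / real (card K)
        - measure (lborel_on s) (anchored_box s y)\<bar>\<^sup>2
    = ((\<Sum>k\<in>K. in_lower_box s y (p k)) / real (card K) - (\<Prod>j\<in>s. y j))\<^sup>2"
proof -
  have "project_points s p k \<in> anchored_box s y \<longleftrightarrow> (\<forall>j\<in>s. 0 \<le> p k j \<and> p k j < y j)" for k
    by (auto simp: project_points_def anchored_box_def PiE_iff)
  then have 1: "real (card {k\<in>K. project_points s p k \<in> anchored_box s y}) = (\<Sum>k\<in>K. in_lower_box s y (p k))"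
    using assms(2) by (simp add: in_lower_box_def sum.If_cases Int_def)
  have "measure (lborel_on s) (anchored_box s y) = (\<Prod>j\<in>s. measure lborel {0..<y j})"
    unfolding anchored_box_def using assms
    by (intro measure_lborel_on_PiE) (auto simp: unit_cube_def PiE_iff)
  also have "\<dots> = (\<Prod>j\<in>s. y j)"
    using assms by (intro prod.cong) (auto simp: unit_cube_def PiE_iff)
  finally show ?thesis using 1 by simp
qed

text \<open>
  The cells tile the unit cube, so the probabilities that the points fall into the box add up to
  \<open>m ^ d\<close> times its volume. Hence the local discrepancy is a normalised sum of centred independent
  indicators, and its expected square is the sum of their variances.
\<close>

lemma expectation_discrepancy_integrand:
  assumes jit: "jittered_point_set d m M X" and m: "m \<ge> 1" and s: "s \<subseteq> {1..d}" and y: "y \<in> unit_cube s"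
  shows "(LINT \<omega>|M. ((\<Sum>i\<in>multi_indices d m. in_lower_box s y (X i \<omega>)) / real (m ^ d) - (\<Prod>j\<in>s. y j))\<^sup>2)
    = (\<Sum>i\<in>multi_indices d m. (\<Prod>j\<in>s. filled m (i j) (y j)) - (\<Prod>j\<in>s. filled m (i j) (y j) ^ 2)) / real m ^ (2 * d)"
proof -
  interpret prob_space M using jit by (simp add: jittered_point_set_def)
  let ?I = "multi_indices d m" and ?L = "lborel_on {1..d}"
  have indep: "indep_vars (\<lambda>_. ?L) X ?I"
    and dist: "\<And>i. i \<in> ?I \<Longrightarrow> distr M ?L (X i) = uniform_measure ?L (jittered_cell d m i)"
    using jit by (auto simp: jittered_point_set_def)
  have X [measurable]: "X i \<in> measurable M ?L" if "i \<in> ?I" for i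
    using indep that by (auto simp: indep_vars_def)
  have fin: "finite s" "finite ?I" using s finite_subset by (auto simp: multi_indices_def intro!: finite_PiE)
  have box: "in_lower_box s y \<in> borel_measurable ?L"
    by (intro borel_measurable_in_lower_box fin s)
  define p where "p i = (\<Prod>j\<in>s. filled m (i j) (y j))" for i
  have p: "expectation (\<lambda>\<omega>. in_lower_box s y (X i \<omega>)) = p i" if i: "i \<in> ?I" for i
  proof -
    have "expectation (\<lambda>\<omega>. in_lower_box s y (X i \<omega>)) = (LINT x|distr M ?L (X i). in_lower_box s y x)"
      by (rule integral_distr[OF X[OF i] box, symmetric])
    also have "\<dots> = (LINT x|distr M ?L (X i). indicator {x \<in> space ?L. \<forall>j\<in>s. 0 \<le> x j \<and> x j < y j} x)"
      by (intro Bochner_Integration.integral_cong) (auto simp: in_lower_box_def)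
    also have "\<dots> = measure (distr M ?L (X i)) {x \<in> space ?L. \<forall>j\<in>s. 0 \<le> x j \<and> x j < y j}"
      by (simp add: Int_absorb2 subset_eq)
    finally show ?thesis
      using measure_uniform_cell_lower_box[OF m i s] dist[OF i] by (simp add: p_def)
  qed
  have sum_p: "(\<Sum>i\<in>?I. p i) = real (m ^ d) * (\<Prod>j\<in>s. y j)"
  proof -
    have "card s \<le> d" using card_mono[OF _ s] by simp
    have "(\<Sum>i\<in>?I. p i) = real m ^ (d - card s) * (\<Prod>j\<in>s. \<Sum>k = 1..m. filled m k (y j))"
      unfolding p_def by (rule sum_multi_indices_prod[OF s])
    also have "(\<Prod>j\<in>s. \<Sum>k = 1..m. filled m k (y j)) = (\<Prod>j\<in>s. real m * y j)"
      using y by (intro prod.cong refl sum_filled) (auto simp: unit_cube_def PiE_iff)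
    also have "real m ^ (d - card s) * (\<Prod>j\<in>s. real m * y j) = real (m ^ d) * (\<Prod>j\<in>s. y j)"
      using \<open>card s \<le> d\<close> by (simp add: prod.distrib power_add[symmetric] mult.assoc[symmetric])
    finally show ?thesis .
  qed
  have "((\<Sum>i\<in>?I. in_lower_box s y (X i \<omega>)) / real (m ^ d) - (\<Prod>j\<in>s. y j))\<^sup>2
      = (\<Sum>i\<in>?I. in_lower_box s y (X i \<omega>) - p i)\<^sup>2 / real m ^ (2 * d)" for \<omega>
  proof -
    have "(\<Sum>i\<in>?I. in_lower_box s y (X i \<omega>)) / real (m ^ d) - (\<Prod>j\<in>s. y j)
      = (\<Sum>i\<in>?I. in_lower_box s y (X i \<omega>) - p i) / real m ^ d"
      using m by (simp add: sum_subtractf sum_p field_simps)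
    then show ?thesis by (simp add: power_divide power_mult[symmetric] mult.commute)
  qed
  moreover have "expectation (\<lambda>\<omega>. (\<Sum>i\<in>?I. in_lower_box s y (X i \<omega>) - p i)\<^sup>2) = (\<Sum>i\<in>?I. p i - (p i)\<^sup>2)"
  proof (rule expectation_square_sum_centered_indicators[OF fin(2) _ _ p])
    show "indep_vars (\<lambda>_. borel) (\<lambda>i \<omega>. in_lower_box s y (X i \<omega>)) ?I"
      by (rule indep_vars_compose2[OF indep]) (rule box)
  qed (auto simp: in_lower_box_def)
  ultimately show ?thesis by (simp add: p_def prod_power_distrib)
qed

text \<open>
  This is the hypothesis of Fubini's theorem: the integrand is measurable in both variables jointly, is
  at most \<open>1\<close> as the square of a difference of two numbers in \<open>{0..1}\<close>, and lives on the
  product of a probability space with a cube of volume \<open>1\<close>.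
\<close>

lemma integrable_discrepancy_integrand:
  assumes jit: "jittered_point_set d m M X" and m: "m \<ge> 1" and s: "s \<subseteq> {1..d}"
  shows "integrable (M \<Otimes>\<^sub>M lborel_on s) (\<lambda>(\<omega>, y). indicator (unit_cube s) y *
    ((\<Sum>i\<in>multi_indices d m. in_lower_box s y (X i \<omega>)) / real (m ^ d) - (\<Prod>j\<in>s. y j))\<^sup>2)"
proof -
  interpret prob_space M using jit by (simp add: jittered_point_set_def)
  interpret product_sigma_finite "\<lambda>_::nat. lborel :: real measure" ..
  let ?I = "multi_indices d m" and ?L = "lborel_on {1..d}"
  let ?f = "\<lambda>(\<omega>, y). ((\<Sum>i\<in>?I. in_lower_box s y (X i \<omega>)) / real (m ^ d) - (\<Prod>j\<in>s. y j))\<^sup>2"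
  have fin: "finite s" "finite ?I" using s finite_subset by (auto simp: multi_indices_def intro!: finite_PiE)
  have card: "card ?I = m ^ d" by (simp add: multi_indices_def card_PiE)
  interpret S: sigma_finite_measure "lborel_on s" by (rule sigma_finite) (rule fin)
  have coord: "(\<lambda>z. snd z j) \<in> borel_measurable (M \<Otimes>\<^sub>M lborel_on s)" if "j \<in> s" for j
    using measurable_compose[OF measurable_snd measurable_component_singleton[of j s "\<lambda>_. lborel"]] that by simp
  have point_coord: "(\<lambda>z. X i (fst z) j) \<in> borel_measurable (M \<Otimes>\<^sub>M lborel_on s)" if "i \<in> ?I" "j \<in> s" for i j
  proof -
    have "X i \<in> measurable M ?L"
      using jit that by (auto simp: jittered_point_set_def indep_vars_def)
    from measurable_compose[OF measurable_compose[OF measurable_fst this] measurable_component_singleton[of j]]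
    show ?thesis using that s by (simp add: subset_eq)
  qed
  have box: "(\<lambda>z. in_lower_box s (snd z) (X i (fst z))) \<in> borel_measurable (M \<Otimes>\<^sub>M lborel_on s)"
    if i: "i \<in> ?I" for i
    unfolding in_lower_box_def
  proof (intro measurable_If measurable_const sets.sets_Collect_finite_All fin sets.sets_Collect_conj)
    fix j assume "j \<in> s"
    note [measurable] = coord[OF this] point_coord[OF i this]
    show "{z \<in> space (M \<Otimes>\<^sub>M lborel_on s). 0 \<le> X i (fst z) j} \<in> sets (M \<Otimes>\<^sub>M lborel_on s)"
      by measurable
    show "{z \<in> space (M \<Otimes>\<^sub>M lborel_on s). X i (fst z) j < snd z j} \<in> sets (M \<Otimes>\<^sub>M lborel_on s)"
      by measurable
  qed simp_all
  have bound: "?f (\<omega>, y) \<le> 1" if "y \<in> unit_cube s" for \<omega> y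
  proof -
    have "0 \<le> (\<Prod>j\<in>s. y j)" "(\<Prod>j\<in>s. y j) \<le> 1"
      using that by (auto simp: unit_cube_def PiE_iff intro!: prod_nonneg prod_le_1)
    moreover have "(\<Sum>i\<in>?I. in_lower_box s y (X i \<omega>)) \<le> real (card ?I) * 1"
      by (rule sum_bounded_above) (simp add: in_lower_box_def)
    then have "(\<Sum>i\<in>?I. in_lower_box s y (X i \<omega>)) / real (m ^ d) \<le> 1"
      using m by (simp add: card divide_le_eq)
    moreover have "0 \<le> (\<Sum>i\<in>?I. in_lower_box s y (X i \<omega>)) / real (m ^ d)"
      by (intro divide_nonneg_nonneg sum_nonneg) (auto simp: in_lower_box_def)
    ultimately show ?thesis by (simp add: abs_square_le_1 abs_le_iff)
  qed
  have "integrable (M \<Otimes>\<^sub>M lborel_on s) (\<lambda>z. indicator (space M \<times> unit_cube s) z *\<^sub>R ?f z)"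
  proof (rule integrableI_bounded_set_indicator[where B = 1])
    show "emeasure (M \<Otimes>\<^sub>M lborel_on s) (space M \<times> unit_cube s) < \<infinity>"
      using fin by (subst S.emeasure_pair_measure_Times) (auto simp: emeasure_unit_cube emeasure_space_1)
    show "?f \<in> borel_measurable (M \<Otimes>\<^sub>M lborel_on s)"
      unfolding split_beta'
      by (intro borel_measurable_power borel_measurable_diff borel_measurable_divide borel_measurable_const
          borel_measurable_sum borel_measurable_prod box coord)
    show "AE z in M \<Otimes>\<^sub>M lborel_on s. z \<in> space M \<times> unit_cube s \<longrightarrow> norm (?f z) \<le> 1"
      using bound by auto
  qed (use fin in auto)
  then show ?thesis
    by (rule Bochner_Integration.integrable_cong[THEN iffD1, rotated -1])
       (auto simp: space_pair_measure indicator_times)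
qed

section \<open>The expected squared discrepancy\<close>

theorem proposition13:
  fixes d m :: nat
    and M :: "'w measure"
    and X :: "(nat \<Rightarrow> nat) \<Rightarrow> 'w \<Rightarrow> nat \<Rightarrow> real"
    and s :: "nat set"
  assumes "d \<ge> 1" and "m \<ge> 2"
    and "jittered_point_set d m M X"
    and "s \<noteq> {}" and "s \<subseteq> {1..d}"
  shows "(LINT \<omega>|M. (L2_discrepancy s (multi_indices d m)
                        (project_points s (\<lambda>i. X i \<omega>)))\<^sup>2)
         = 1 / real m ^ (d + card s) *
             (((real m - 1) / 2 + 1 / 2) ^ card s - ((real m - 1) / 2 + 1 / 3) ^ card s)"
proof -
  interpret prob_space M using assms(3) by (simp add: jittered_point_set_def)
  interpret product_sigma_finite "\<lambda>_::nat. lborel :: real measure" ..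
  let ?I = "multi_indices d m" and ?L = "lborel_on s"
  have m: "m \<ge> 1" using assms by simp
  have fin: "finite s" "finite ?I" using assms(5) finite_subset by (auto simp: multi_indices_def intro!: finite_PiE)
  have card: "card ?I = m ^ d" by (simp add: multi_indices_def card_PiE)
  have cs: "card s \<le> d" using card_mono[OF _ assms(5)] by simp
  interpret S: sigma_finite_measure ?L by (rule sigma_finite) (rule fin)
  interpret P: pair_sigma_finite M ?L ..
  define D where "D \<omega> y = ((\<Sum>i\<in>?I. in_lower_box s y (X i \<omega>)) / real (m ^ d) - (\<Prod>j\<in>s. y j))\<^sup>2" for \<omega> y
  \<comment> \<open>The cell probability for \<open>r = 1\<close> and its square for \<open>r = 2\<close>.\<close>
  define q where "q r i y = (\<Prod>j\<in>s. filled m (i j) (y j) ^ r)" for r i y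
  have sum_q: "(\<Sum>i\<in>?I. LINT y:unit_cube s|?L. q r i y)
      = real m ^ (d - card s) * ((real m - 1) / 2 + 1 / (real r + 1)) ^ card s" if "r \<ge> 1" for r
  proof -
    have "(\<Sum>i\<in>?I. LINT y:unit_cube s|?L. q r i y)
        = (\<Sum>i\<in>?I. \<Prod>j\<in>s. (real m - real (i j) + 1 / (real r + 1)) / real m)"
    proof (intro sum.cong refl)
      fix i assume i: "i \<in> ?I"
      have ij: "1 \<le> i j" "i j \<le> m" if "j \<in> s" for j
        using i that assms(5) by (auto simp: multi_indices_def PiE_iff subset_eq)
      show "(LINT y:unit_cube s|?L. q r i y) = (\<Prod>j\<in>s. (real m - real (i j) + 1 / (real r + 1)) / real m)"
        unfolding q_def
        by (subst set_integral_unit_cube_prod[OF fin(1)])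
           (auto intro!: prod.cong integral_filled_power ij that)
    qed
    also have "\<dots> = real m ^ (d - card s) * ((real m - 1) / 2 + 1 / (real r + 1)) ^ card s"
      using sum_multi_indices_prod[OF assms(5), of "\<lambda>j k. (real m - real k + 1 / (real r + 1)) / real m" m]
      by (simp only: sum_filled_power_integrals[OF m] prod_constant)
    finally show ?thesis .
  qed
  have "(L2_discrepancy s ?I (project_points s (\<lambda>i. X i \<omega>)))\<^sup>2 = (LINT y|?L. indicator (unit_cube s) y * D \<omega> y)" for \<omega>
  proof -
    have "(LINT y:unit_cube s|?L. \<bar>real (card {k \<in> ?I. project_points s (\<lambda>i. X i \<omega>) k \<in> anchored_box s y}) / real (card ?I)
        - measure ?L (anchored_box s y)\<bar>\<^sup>2) = (LINT y|?L. indicator (unit_cube s) y * D \<omega> y)"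
      unfolding set_lebesgue_integral_def
    proof (intro Bochner_Integration.integral_cong refl)
      fix y
      show "indicator (unit_cube s) y *\<^sub>R \<bar>real (card {k \<in> ?I. project_points s (\<lambda>i. X i \<omega>) k \<in> anchored_box s y}) / real (card ?I)
        - measure ?L (anchored_box s y)\<bar>\<^sup>2 = indicator (unit_cube s) y * D \<omega> y"
        using discrepancy_integrand[OF fin, of y "\<lambda>i. X i \<omega>"]
        by (cases "y \<in> unit_cube s") (simp_all add: D_def card)
    qed
    moreover have "0 \<le> (LINT y|?L. indicator (unit_cube s) y * D \<omega> y)"
      by (intro Bochner_Integration.integral_nonneg) (auto simp: D_def)
    ultimately show ?thesis unfolding L2_discrepancy_def by (simp only: real_sqrt_pow2)
  qed
  then have "(LINT \<omega>|M. (L2_discrepancy s ?I (project_points s (\<lambda>i. X i \<omega>)))\<^sup>2)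
      = (LINT \<omega>|M. LINT y|?L. indicator (unit_cube s) y * D \<omega> y)"
    by simp
  also have "\<dots> = (LINT y|?L. LINT \<omega>|M. indicator (unit_cube s) y * D \<omega> y)"
    by (rule P.Fubini_integral[symmetric])
       (use integrable_discrepancy_integrand[OF assms(3) m assms(5)] in \<open>simp add: D_def\<close>)
  also have "\<dots> = (LINT y:unit_cube s|?L. (\<Sum>i\<in>?I. q 1 i y - q 2 i y) / real m ^ (2 * d))"
    unfolding set_lebesgue_integral_def
  proof (intro Bochner_Integration.integral_cong refl)
    fix y
    show "(LINT \<omega>|M. indicator (unit_cube s) y * D \<omega> y)
        = indicator (unit_cube s) y *\<^sub>R ((\<Sum>i\<in>?I. q 1 i y - q 2 i y) / real m ^ (2 * d))"
      using expectation_discrepancy_integrand[OF assms(3) m assms(5), of y]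
      by (cases "y \<in> unit_cube s") (simp_all add: D_def q_def)
  qed
  also have "\<dots> = (\<Sum>i\<in>?I. (LINT y:unit_cube s|?L. q 1 i y) - (LINT y:unit_cube s|?L. q 2 i y)) / real m ^ (2 * d)"
  proof -
    have "set_integrable ?L (unit_cube s) (q r i)" if "i \<in> ?I" "r \<ge> 1" for r i
      unfolding q_def using that assms(5)
      by (intro set_integral_unit_cube_prod fin integral_filled_power) (auto simp: multi_indices_def PiE_iff subset_eq)
    then have "set_integrable ?L (unit_cube s) (q 1 i)" "set_integrable ?L (unit_cube s) (q 2 i)"
      if "i \<in> ?I" for i
      using that by simp_all
    then show ?thesis
      by (simp add: set_lebesgue_integral_def set_integrable_def sum_distrib_left right_diff_distrib)
  qed
  also have "\<dots> = real m ^ (d - card s) / real m ^ (2 * d) *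
      (((real m - 1) / 2 + 1 / 2) ^ card s - ((real m - 1) / 2 + 1 / 3) ^ card s)"
    using sum_q[of 1] sum_q[of 2] by (simp add: sum_subtractf right_diff_distrib diff_divide_distrib)
  also have "real m ^ (d - card s) / real m ^ (2 * d) = 1 / real m ^ (d + card s)"
  proof -
    have "2 * d = (d - card s) + (d + card s)" using cs by simp
    then have "real m ^ (2 * d) = real m ^ (d - card s) * real m ^ (d + card s)"
      by (simp only: power_add)
    then show ?thesis using m by simp
  qed
  finally show ?thesis .
qed

end
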